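(* Let $T\in\mathbb{R}^{m\times n}$, regarded as an element of $\ell_\infty^n\otimes\ell_2^m$, i.e. as a linear operator $T:\ell_1^n\to\ell_2^m$ with adjoint $T^*:\ell_2^m\to\ell_\infty^n$. Then $$\pi_2(T^* )=\inf\{\|T_1\|_{\mathrm F}\|T_2\|:\ d\in\mathbb{N},\ T_1\in L(\ell_2^d,\ell_2^m),\ T_2\in L(\ell_1^n,\ell_2^d),\ T=T_1T_2\},$$ and this quantity is given by the semidefinite program $$\pi_2(T^* )=\inf_{W_1,W_2}\ \max\big(\mathrm{trace}(W_1),\ \|\mathrm{diag}(W_2)\|_\infty\big)\quad\text{s.t.}\quad\begin{bmatrix} W_1 & T \\ T^* & W_2 \end{bmatrix}\succeq0,$$ where $W_1\in\mathbb{R}^{m\times m}$ and $W_2\in\mathbb{R}^{n\times n}$ are symmetric.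
   Context: For a linear operator $S:E\to F$ between Banach spaces, the 2-summing norm $\pi_2(S)$ is the smallest $c>0$ such that $\sum_k\|Sz_k\|_F^2\le c^2\sup_{z^*\in B_{E^*}}\sum_k|z^*(z_k)|^2$ for all finite sequences $(z_k)\subset E$. $L(E,F)$ is the space of linear operators $E\to F$; $\|\cdot\|_{\mathrm F}$ is the Frobenius norm; $\|T_2\|$ is the operator norm $\ell_1^n\to\ell_2^d$, i.e. the maximum Euclidean column norm. In the block matrix $T^*$ is the transpose of $T$; $\mathrm{diag}(W)$ is the vector of diagonal entries of $W$; $\succeq0$ means positive semidefinite. (The factorization infimum in the claim is what the paper calls the mixed norm of $T$.) *)

theory Defs
  imports "HOL-Analysis.Analysis"
begin

text \<open>
  The type \<^typ>\<open>real ^ 'n\<close> carries the Euclidean norm by default, whereas several norms on the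
  same space are needed here.  Norms are therefore passed as explicit arguments.  The
  \<open>\<ell>\<^sub>\<infinity>\<close>-norm is \<^const>\<open>infnorm\<close>.
\<close>

definition l1norm :: "real ^ 'n \<Rightarrow> real" where
  "l1norm x = (\<Sum>j\<in>UNIV. \<bar>x $ j\<bar>)"

definition dual_unit_ball :: "('a::real_vector \<Rightarrow> real) \<Rightarrow> ('a \<Rightarrow> real) set" where
  "dual_unit_ball nE = {f. linear f \<and> (\<forall>x. \<bar>f x\<bar> \<le> nE x)}"

definition two_summing_bound ::
  "('a::real_vector \<Rightarrow> real) \<Rightarrow> ('b::real_vector \<Rightarrow> real) \<Rightarrow> ('a \<Rightarrow> 'b) \<Rightarrow> real \<Rightarrow> bool" where
  "two_summing_bound nE nF S c \<longleftrightarrow>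
     (\<forall>(N::nat) (z :: nat \<Rightarrow> 'a).
        (\<Sum>k<N. (nF (S (z k)))\<^sup>2) \<le> c\<^sup>2 * (SUP f\<in>dual_unit_ball nE. \<Sum>k<N. \<bar>f (z k)\<bar>\<^sup>2))"

text \<open>
  The value is \<open>\<infinity>\<close> when no constant works.  An infimum is taken because for \<open>S = 0\<close> there is no
  smallest \<open>c > 0\<close>.
\<close>

definition two_summing_norm ::
  "('a::real_vector \<Rightarrow> real) \<Rightarrow> ('b::real_vector \<Rightarrow> real) \<Rightarrow> ('a \<Rightarrow> 'b) \<Rightarrow> ereal" where
  "two_summing_norm nE nF S = Inf {ereal c | c. 0 < c \<and> two_summing_bound nE nF S c}"

definition opnorm_wrt :: "('a \<Rightarrow> real) \<Rightarrow> ('b \<Rightarrow> real) \<Rightarrow> ('a \<Rightarrow> 'b) \<Rightarrow> real" where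
  "opnorm_wrt nE nF S = (SUP x\<in>{x. nE x \<le> 1}. nF (S x))"

text \<open>
  The inner dimension \<open>d\<close> of a factorization \<open>T = T\<^sub>1 T\<^sub>2\<close> is a bound variable, so it cannot be a
  type.  The factors are matrices whose inner index is a natural number; only the indices
  \<open>k < d\<close> matter, and \<open>\<ell>\<^sub>2\<^sup>d\<close> is the space of functions on \<open>{..<d}\<close> with norm \<^const>\<open>L2_set\<close>.
\<close>

definition factorizes ::
  "real ^ 'n ^ 'm \<Rightarrow> nat \<Rightarrow> ('m \<Rightarrow> nat \<Rightarrow> real) \<Rightarrow> (nat \<Rightarrow> 'n \<Rightarrow> real) \<Rightarrow> bool" where
  "factorizes T d T1 T2 \<longleftrightarrow> (\<forall>i j. T $ i $ j = (\<Sum>k<d. T1 i k * T2 k j))"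

definition frobenius_norm :: "nat \<Rightarrow> ('m::finite \<Rightarrow> nat \<Rightarrow> real) \<Rightarrow> real" where
  "frobenius_norm d A = sqrt (\<Sum>i\<in>UNIV. \<Sum>k<d. (A i k)\<^sup>2)"

definition opnorm_l1_l2 :: "nat \<Rightarrow> (nat \<Rightarrow> 'n::finite \<Rightarrow> real) \<Rightarrow> real" where
  "opnorm_l1_l2 d A =
     opnorm_wrt l1norm (\<lambda>v. L2_set v {..<d})
       (\<lambda>x :: real ^ 'n. \<lambda>k. \<Sum>j\<in>UNIV. A k j * x $ j)"

definition block_matrix ::
  "'a ^ 'n1 ^ 'm1 \<Rightarrow> 'a ^ 'n2 ^ 'm1 \<Rightarrow> 'a ^ 'n1 ^ 'm2 \<Rightarrow> 'a ^ 'n2 ^ 'm2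
    \<Rightarrow> 'a ^ ('n1 + 'n2) ^ ('m1 + 'm2)" where
  "block_matrix A B C D =
     (\<chi> i j. case i of
        Inl a \<Rightarrow> (case j of Inl b \<Rightarrow> A $ a $ b | Inr b \<Rightarrow> B $ a $ b)
      | Inr a \<Rightarrow> (case j of Inl b \<Rightarrow> C $ a $ b | Inr b \<Rightarrow> D $ a $ b))"

definition symmetric_matrix :: "real ^ 'n ^ 'n \<Rightarrow> bool" where
  "symmetric_matrix M \<longleftrightarrow> transpose M = M"

definition pos_semidef :: "real ^ 'n ^ 'n \<Rightarrow> bool" where
  "pos_semidef M \<longleftrightarrow> symmetric_matrix M \<and> (\<forall>x. 0 \<le> x \<bullet> (M *v x))"

definition diag_vec :: "real ^ 'n ^ 'n \<Rightarrow> real ^ 'n" where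
  "diag_vec M = (\<chi> i. M $ i $ i)"

end

theory Submission
  imports Defs
begin

text \<open>
  Write \<open>t\<^sub>j\<close> for the columns of \<open>T\<close>, so that \<open>T\<^sup>*\<close> maps \<open>z\<close> to the vector of the
  numbers \<open>t\<^sub>j \<bullet> z\<close>.  The 2-summing norm, the factorization infimum and the semidefinite program
  are three descriptions of the same datum: a positive semidefinite \<open>P\<close> of small trace with
  \<open>(t\<^sub>j \<bullet> z)\<^sup>2 \<le> z \<bullet> P z\<close> for all \<open>j\<close> and \<open>z\<close>.

  A factorization \<open>T = T\<^sub>1 T\<^sub>2\<close> yields such a \<open>P\<close>, namely \<open>T\<^sub>1 T\<^sub>1\<^sup>*\<close> scaled by the square of
  the largest column norm of \<open>T\<^sub>2\<close>, and summing the inequality over a sequence \<open>z\<^sub>k\<close>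
  gives the 2-summing estimate (\<open>two_summing_bound_factorization\<close>).  Conversely, the 2-summing
  inequality with constant \<open>c\<close> says that two convex cones of pairs (matrix, number) are disjoint; a
  separating hyperplane is a matrix \<open>P\<close> of trace at most \<open>c\<^sup>2\<close> that dominates
  (\<open>pietsch_domination\<close>).  Here \<open>P\<close> plays the role of the second-moment matrix of the Pietsch
  measure, so no measure has to be constructed.  Writing \<open>P = V\<^sup>* V\<close>
  (\<open>pos_semidef_gram\<close>), domination becomes \<open>\<bar>t\<^sub>j \<bullet> z\<bar> \<le> \<parallel>V z\<parallel>\<close>, which forces
  \<open>t\<^sub>j = V\<^sup>* u\<^sub>j\<close> with \<open>\<parallel>u\<^sub>j\<parallel> \<le> 1\<close> (\<open>dominated_functional_factors\<close>).  So \<open>T\<close> factors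
  through \<open>V\<^sup>*\<close>, whose Frobenius norm is the square root of the trace of \<open>P\<close>.

  The semidefinite program is compared with factorizations directly: the block matrix is positive
  semidefinite exactly when it is a Gram matrix, and splitting the Gram vectors by block gives
  \<open>T\<^sub>1\<close> and \<open>T\<^sub>2\<close> with \<open>W\<^sub>1 = T\<^sub>1 T\<^sub>1\<^sup>*\<close> and \<open>W\<^sub>2 = T\<^sub>2\<^sup>* T\<^sub>2\<close>.  The factors may be rescaled by
  \<open>s\<close> and \<open>1 / s\<close>, and balancing them turns the product of the norms into the maximum of
  their squares.
\<close>

section \<open>Gram factorizations of positive semidefinite matrices\<close>

lemma quadratic_form_eq_sum:
  fixes M :: "real ^ 'n ^ 'n"
  shows "x \<bullet> (M *v x) = (\<Sum>i\<in>UNIV. \<Sum>j\<in>UNIV. M $ i $ j * x $ i * x $ j)"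
  by (simp add: inner_vec_def matrix_vector_mult_def sum_distrib_left algebra_simps)

lemma pos_semidef_gramI:
  fixes M :: "real ^ 'n ^ 'n" and v :: "'k \<Rightarrow> 'n \<Rightarrow> real"
  assumes M: "\<And>i j. M $ i $ j = (\<Sum>k\<in>K. v k i * v k j)"
  shows "pos_semidef M"
proof -
  have "symmetric_matrix M"
    by (simp add: symmetric_matrix_def transpose_def vec_eq_iff M mult.commute)
  moreover have "0 \<le> x \<bullet> (M *v x)" for x
  proof -
    have "x \<bullet> (M *v x)
        = (\<Sum>i\<in>UNIV. \<Sum>j\<in>UNIV. \<Sum>k\<in>K. (v k i * x $ i) * (v k j * x $ j))"
      by (simp add: quadratic_form_eq_sum M sum_distrib_left algebra_simps)
    also have "\<dots> = (\<Sum>i\<in>UNIV. \<Sum>k\<in>K. \<Sum>j\<in>UNIV. (v k i * x $ i) * (v k j * x $ j))"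
      by (intro sum.cong refl sum.swap)
    also have "\<dots> = (\<Sum>k\<in>K. \<Sum>i\<in>UNIV. \<Sum>j\<in>UNIV. (v k i * x $ i) * (v k j * x $ j))"
      by (rule sum.swap)
    also have "\<dots> = (\<Sum>k\<in>K. (\<Sum>i\<in>UNIV. v k i * x $ i)\<^sup>2)"
      by (simp add: power2_eq_square sum_product)
    finally show ?thesis
      by (simp add: sum_nonneg)
  qed
  ultimately show ?thesis
    by (simp add: pos_semidef_def)
qed

text \<open>
  Viewed as a quadratic polynomial in \<open>t\<close>, this expresses Cauchy-Schwarz for the form \<open>M\<close> against a
  basis vector: nonnegativity at the minimizer bounds the square of a component of \<open>M x\<close>.
\<close>

lemma quadratic_form_minus_axis:
  fixes M :: "real ^ 'n ^ 'n"
  assumes "symmetric_matrix M"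
  shows "(x - t *\<^sub>R axis p 1) \<bullet> (M *v (x - t *\<^sub>R axis p 1))
    = x \<bullet> (M *v x) - 2 * t * (M *v x) $ p + t\<^sup>2 * M $ p $ p"
proof -
  have Ma: "(M *v axis p 1) = M $ p"
    using assms by (metis matrix_vector_mult_basis row_transpose row_def vec_nth_inverse
        symmetric_matrix_def)
  have "x \<bullet> M $ p = (M *v x) $ p"
    by (simp add: matrix_vector_mul_component inner_commute)
  then show ?thesis
    by (simp add: matrix_vector_mult_diff_distrib matrix_vector_mult_scaleR Ma inner_diff_left
        inner_diff_right inner_axis' power2_eq_square algebra_simps)
qed

text \<open>
  The Cholesky decomposition, by induction on the support.  Subtracting the rank-one matrix built
  from the pivot row clears that row, and Cauchy-Schwarz keeps the remainder positive semidefinite.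
  A zero pivot already forces a zero row.  Each element of \<open>F\<close> contributes at most one Gram vector,
  so the vectors can be indexed by \<open>F\<close> itself, which makes the factor square.
\<close>

lemma pos_semidef_supported_gram:
  fixes M :: "real ^ 'n ^ 'n"
  assumes "finite F" "pos_semidef M" "\<And>i j. i \<notin> F \<Longrightarrow> M $ i $ j = 0"
  shows "\<exists>v :: 'n \<Rightarrow> 'n \<Rightarrow> real. \<forall>i j. M $ i $ j = (\<Sum>k\<in>F. v k i * v k j)"
  using assms
proof (induction F arbitrary: M rule: finite_induct)
  case empty
  then show ?case by simp
next
  case (insert p F)
  have symM: "symmetric_matrix M" and psd: "\<And>x. 0 \<le> x \<bullet> (M *v x)"
    using insert.prems(1) by (auto simp: pos_semidef_def)
  have sym: "M $ i $ j = M $ j $ i" for i j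
    using symM unfolding symmetric_matrix_def by (metis transpose_def vec_lambda_beta)
  have pivot: "0 \<le> x \<bullet> (M *v x) - 2 * t * (M *v x) $ p + t\<^sup>2 * M $ p $ p" for x t
    using psd quadratic_form_minus_axis[OF symM] by metis
  show ?case
  proof (cases "M $ p $ p = 0")
    case True
    have "(M *v x) $ p = 0" for x
    proof (rule ccontr)
      assume ne: "(M *v x) $ p \<noteq> 0"
      \<comment> \<open>For a zero pivot the polynomial in \<open>t\<close> is linear; this \<open>t\<close> gives it the value \<open>-1\<close>.\<close>
      then show False
        using pivot[of x "(x \<bullet> (M *v x) + 1) / (2 * (M *v x) $ p)"] True by simp
    qed
    then have "M $ p $ j = 0" for j
      by (metis column_def matrix_vector_mult_basis vec_lambda_beta)
    then have "\<And>i j. i \<notin> F \<Longrightarrow> M $ i $ j = 0"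
      using insert.prems(2) by (metis insert_iff)
    then obtain v :: "'n \<Rightarrow> 'n \<Rightarrow> real"
      where v: "\<And>i j. M $ i $ j = (\<Sum>k\<in>F. v k i * v k j)"
      using insert.IH[OF insert.prems(1)] by blast
    have "\<forall>i j. M $ i $ j = (\<Sum>k\<in>insert p F. (v(p := (\<lambda>_. 0))) k i * (v(p := (\<lambda>_. 0))) k j)"
      using insert.hyps by (auto simp: v intro!: sum.cong)
    then show ?thesis by blast
  next
    case False
    have "M $ p $ p \<ge> 0"
      using psd[of "axis p 1"] by (simp add: matrix_vector_mult_basis column_def inner_axis')
    with False have pos: "M $ p $ p > 0" by simp
    define a where "a i = M $ p $ i / sqrt (M $ p $ p)" for i
    define M' :: "real ^ 'n ^ 'n" where "M' = (\<chi> i j. M $ i $ j - a i * a j)"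
    have aa: "a i * a j = M $ p $ i * M $ p $ j / M $ p $ p" for i j
      using pos by (simp add: a_def)
    have "pos_semidef M'"
      unfolding pos_semidef_def
    proof
      show "symmetric_matrix M'"
        using sym by (simp add: symmetric_matrix_def transpose_def M'_def vec_eq_iff)
      show "\<forall>x. 0 \<le> x \<bullet> (M' *v x)"
      proof
        fix x
        have "(\<Sum>i\<in>UNIV. \<Sum>j\<in>UNIV. (a i * a j) * x $ i * x $ j)
            = (\<Sum>i\<in>UNIV. M $ p $ i * x $ i)\<^sup>2 / M $ p $ p"
          unfolding power2_eq_square aa
          by (simp add: sum_product sum_divide_distrib algebra_simps)
        then have "x \<bullet> (M' *v x) = x \<bullet> (M *v x) - ((M *v x) $ p)\<^sup>2 / M $ p $ p"
          by (simp add: quadratic_form_eq_sum M'_def left_diff_distrib sum_subtractf)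
             (simp add: matrix_vector_mult_def)
        also have "\<dots> \<ge> 0"
          using pivot[of x "(M *v x) $ p / M $ p $ p"] pos
          by (simp add: power2_eq_square field_simps)
        finally show "0 \<le> x \<bullet> (M' *v x)" .
      qed
    qed
    moreover have "M' $ i $ j = 0" if "i \<notin> F" for i j
    proof (cases "i = p")
      case True
      then show ?thesis using pos by (simp add: M'_def aa)
    next
      case False
      then have "M $ i $ j' = 0" for j' using insert.prems(2) that by simp
      then show ?thesis using sym[of p i] by (simp add: M'_def aa)
    qed
    ultimately obtain v :: "'n \<Rightarrow> 'n \<Rightarrow> real"
      where v: "\<And>i j. M' $ i $ j = (\<Sum>k\<in>F. v k i * v k j)"
      using insert.IH by blast
    have "M $ i $ j = (\<Sum>k\<in>insert p F. (v(p := a)) k i * (v(p := a)) k j)" for i j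
    proof -
      have "(\<Sum>k\<in>F. (v(p := a)) k i * (v(p := a)) k j) = M' $ i $ j"
        using insert.hyps(2) unfolding v by (intro sum.cong) auto
      then show ?thesis
        using insert.hyps by (simp add: M'_def)
    qed
    then show ?thesis by blast
  qed
qed

lemma pos_semidef_gram:
  fixes M :: "real ^ 'n ^ 'n"
  assumes "pos_semidef M"
  obtains v :: "'n \<Rightarrow> 'n \<Rightarrow> real" where "\<And>i j. M $ i $ j = (\<Sum>k\<in>UNIV. v k i * v k j)"
proof -
  have "\<exists>v :: 'n \<Rightarrow> 'n \<Rightarrow> real. \<forall>i j. M $ i $ j = (\<Sum>k\<in>UNIV. v k i * v k j)"
    by (rule pos_semidef_supported_gram) (use assms in auto)
  with that show ?thesis by blast
qed

section \<open>The norms in coordinates\<close>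

lemma infnorm_le_iff_cart:
  fixes x :: "real ^ 'n"
  shows "infnorm x \<le> b \<longleftrightarrow> (\<forall>i. \<bar>x $ i\<bar> \<le> b)"
proof
  assume "infnorm x \<le> b"
  then show "\<forall>i. \<bar>x $ i\<bar> \<le> b"
    using component_le_infnorm_cart order_trans by blast
next
  assume "\<forall>i. \<bar>x $ i\<bar> \<le> b"
  then show "infnorm x \<le> b"
    unfolding infnorm_cart by (intro cSup_least) auto
qed

lemma L2_set_sum_le:
  assumes "finite J"
  shows "L2_set (\<lambda>k. \<Sum>j\<in>J. f k j) K \<le> (\<Sum>j\<in>J. L2_set (\<lambda>k. f k j) K)"
  using assms
proof (induction J rule: finite_induct)
  case empty
  then show ?case by (simp add: L2_set_def)
next
  case (insert j J)
  have "L2_set (\<lambda>k. f k j + (\<Sum>j\<in>J. f k j)) K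
      \<le> L2_set (\<lambda>k. f k j) K + L2_set (\<lambda>k. \<Sum>j\<in>J. f k j) K"
    by (rule L2_set_triangle_ineq)
  with insert show ?case by simp
qed

lemma L2_set_mult_right_abs: "L2_set (\<lambda>k. f k * c) K = \<bar>c\<bar> * L2_set f K"
  by (simp add: L2_set_def power_mult_distrib real_sqrt_mult flip: sum_distrib_right)

text \<open>
  An operator on \<open>\<ell>\<^sub>1\<close> attains its norm at a basis vector, because the unit ball is the convex hull
  of the vectors \<open>\<plusminus>e\<^sub>j\<close>; the next lemmas identify its norm with the maximal column norm.
\<close>

lemma L2_set_apply_le:
  fixes x :: "real ^ 'n"
  assumes "\<And>j. L2_set (\<lambda>k. A k j) {..<d} \<le> b" "l1norm x \<le> 1"
  shows "L2_set (\<lambda>k. \<Sum>j\<in>UNIV. A k j * x $ j) {..<d} \<le> b"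
proof -
  have b: "0 \<le> b"
    using assms(1) L2_set_nonneg order_trans by blast
  have "L2_set (\<lambda>k. \<Sum>j\<in>UNIV. A k j * x $ j) {..<d}
      \<le> (\<Sum>j\<in>UNIV. \<bar>x $ j\<bar> * L2_set (\<lambda>k. A k j) {..<d})"
    using L2_set_sum_le[of UNIV "\<lambda>k j. A k j * x $ j" "{..<d}"]
    by (simp add: L2_set_mult_right_abs)
  also have "\<dots> \<le> (\<Sum>j\<in>UNIV. \<bar>x $ j\<bar> * b)"
    by (intro sum_mono mult_left_mono assms(1)) auto
  also have "\<dots> = l1norm x * b"
    by (simp add: l1norm_def sum_distrib_right)
  also have "\<dots> \<le> b"
    using assms(2) b by (simp add: mult_left_le_one_le l1norm_def sum_nonneg)
  finally show ?thesis .
qed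

lemma opnorm_l1_l2_le:
  fixes A :: "nat \<Rightarrow> 'n::finite \<Rightarrow> real"
  assumes "\<And>j. L2_set (\<lambda>k. A k j) {..<d} \<le> b"
  shows "opnorm_l1_l2 d A \<le> b"
proof -
  have "(0 :: real ^ 'n) \<in> {x. l1norm x \<le> 1}"
    by (simp add: l1norm_def)
  then show ?thesis
    unfolding opnorm_l1_l2_def opnorm_wrt_def
    by (intro cSUP_least) (auto intro: L2_set_apply_le assms)
qed

text \<open>
  The operator norm is a supremum of reals, so boundedness is needed before evaluating it at a
  basis vector; the sum of the column norms is a crude bound.
\<close>

lemma column_le_opnorm_l1_l2:
  fixes A :: "nat \<Rightarrow> 'n::finite \<Rightarrow> real"
  shows "L2_set (\<lambda>k. A k j) {..<d} \<le> opnorm_l1_l2 d A"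
proof -
  define b where "b = (\<Sum>j\<in>UNIV. L2_set (\<lambda>k. A k j) {..<d})"
  have b: "L2_set (\<lambda>k. A k j) {..<d} \<le> b" for j
    unfolding b_def by (rule member_le_sum) auto
  have "l1norm (axis j 1 :: real ^ 'n) \<le> 1"
    by (simp add: l1norm_def axis_def if_distrib cong: if_cong)
  moreover have "bdd_above ((\<lambda>x :: real ^ 'n. L2_set (\<lambda>k. \<Sum>j\<in>UNIV. A k j * x $ j) {..<d})
      ` {x. l1norm x \<le> 1})"
    by (rule bdd_aboveI2[where M = b]) (use L2_set_apply_le[OF b] in auto)
  ultimately have "L2_set (\<lambda>k. \<Sum>i\<in>UNIV. A k i * (axis j 1 :: real ^ 'n) $ i) {..<d}
      \<le> opnorm_l1_l2 d A"
    unfolding opnorm_l1_l2_def opnorm_wrt_def by (intro cSUP_upper) auto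
  then show ?thesis
    by (simp add: axis_def if_distrib cong: if_cong)
qed

lemma opnorm_l1_l2_nonneg: "0 \<le> opnorm_l1_l2 d A"
  by (rule order_trans[OF L2_set_nonneg column_le_opnorm_l1_l2[of A undefined]])

lemma frobenius_norm_nonneg: "0 \<le> frobenius_norm d A"
  by (simp add: frobenius_norm_def sum_nonneg)

text \<open>
  Gram factorizations are indexed by a finite type; renumbering it turns them into
  factorizations through \<open>\<ell>\<^sub>2\<^sup>d\<close>.
\<close>

lemma finite_type_factorization:
  fixes T :: "real ^ 'n ^ 'm" and A :: "'m \<Rightarrow> 'k::finite \<Rightarrow> real" and B :: "'k \<Rightarrow> 'n \<Rightarrow> real"
  assumes T: "\<And>i j. T $ i $ j = (\<Sum>k\<in>UNIV. A i k * B k j)"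
    and B: "\<And>j. (\<Sum>k\<in>UNIV. (B k j)\<^sup>2) \<le> b"
  obtains d T1 T2 where "factorizes T d T1 T2"
    "frobenius_norm d T1 * opnorm_l1_l2 d T2 \<le> sqrt ((\<Sum>i\<in>UNIV. \<Sum>k\<in>UNIV. (A i k)\<^sup>2) * b)"
proof -
  obtain h where h: "bij_betw h {..<CARD('k)} (UNIV :: 'k set)"
    using ex_bij_betw_nat_finite[of "UNIV :: 'k set"] by (auto simp: atLeast0LessThan)
  define d where "d = CARD('k)"
  have reindex: "(\<Sum>k<d. g (h k)) = (\<Sum>k\<in>UNIV. g k)" for g :: "'k \<Rightarrow> real"
    unfolding d_def by (rule sum.reindex_bij_betw[OF h])
  define T1 where "T1 i k = A i (h k)" for i k
  define T2 where "T2 k j = B (h k) j" for k j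
  have "factorizes T d T1 T2"
    unfolding factorizes_def T1_def T2_def T by (simp add: reindex[of "\<lambda>k. A _ k * B k _"])
  moreover have "frobenius_norm d T1 = sqrt (\<Sum>i\<in>UNIV. \<Sum>k\<in>UNIV. (A i k)\<^sup>2)"
    unfolding frobenius_norm_def T1_def by (simp add: reindex[of "\<lambda>k. (A _ k)\<^sup>2"])
  moreover have "opnorm_l1_l2 d T2 \<le> sqrt b"
    by (rule opnorm_l1_l2_le)
      (use B in \<open>simp add: L2_set_def T2_def reindex[of "\<lambda>k. (B k _)\<^sup>2"]\<close>)
  ultimately show ?thesis
    using that[of d T1 T2] by (simp add: real_sqrt_mult mult_left_mono sum_nonneg)
qed

section \<open>Weak sums over the dual ball of a Euclidean space\<close>

lemma dual_unit_ball_norm: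
  "dual_unit_ball (norm :: 'a::euclidean_space \<Rightarrow> real) = (\<lambda>y x. y \<bullet> x) ` cball 0 1"
proof (intro equalityI subsetI)
  fix f assume "f \<in> dual_unit_ball (norm :: 'a \<Rightarrow> real)"
  then have lin: "linear f" and le: "\<And>x. \<bar>f x\<bar> \<le> norm x"
    by (auto simp: dual_unit_ball_def)
  define y where "y = adjoint f 1"
  have f: "f x = y \<bullet> x" for x
    using adjoint_works[OF lin, of x 1] by (simp add: y_def inner_commute)
  have "norm y * norm y \<le> norm y"
    using le[of y] by (simp add: f dot_square_norm power2_eq_square)
  then have "norm y \<le> 1"
    by (metis mult_cancel_left1 mult_le_cancel_left1 norm_ge_zero not_le order_refl zero_le_one
        order_less_le)
  then show "f \<in> (\<lambda>y x. y \<bullet> x) ` cball 0 1"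
    using f by (auto simp: image_iff fun_eq_iff)
next
  fix f :: "'a \<Rightarrow> real" assume "f \<in> (\<lambda>y x. y \<bullet> x) ` cball 0 1"
  then obtain y :: 'a where y: "norm y \<le> 1" "f = (\<lambda>x. y \<bullet> x)" by auto
  have "\<bar>y \<bullet> x\<bar> \<le> norm x" for x
    using Cauchy_Schwarz_ineq2[of y x] y(1) mult_left_le_one_le[of "norm x" "norm y"] by simp
  then show "f \<in> dual_unit_ball norm"
    using y by (auto simp: dual_unit_ball_def bounded_linear_inner_right bounded_linear.linear)
qed

lemma weak_sum_le_SUP:
  fixes z :: "nat \<Rightarrow> 'a::euclidean_space"
  shows "(\<Sum>k<N. (y \<bullet> z k)\<^sup>2)
    \<le> (norm y)\<^sup>2 * (SUP f\<in>dual_unit_ball norm. \<Sum>k<N. \<bar>f (z k)\<bar>\<^sup>2)"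
proof (cases "y = 0")
  case False
  define u where "u = y /\<^sub>R norm y"
  have "(\<lambda>x. u \<bullet> x) \<in> dual_unit_ball norm"
    unfolding dual_unit_ball_norm using False by (intro imageI) (simp add: u_def)
  moreover have "bdd_above ((\<lambda>f. \<Sum>k<N. \<bar>f (z k)\<bar>\<^sup>2) ` dual_unit_ball norm)"
    by (rule bdd_aboveI2[where M = "\<Sum>k<N. (norm (z k))\<^sup>2"], intro sum_mono power_mono)
      (simp_all add: dual_unit_ball_def)
  ultimately have "(\<Sum>k<N. \<bar>u \<bullet> z k\<bar>\<^sup>2) \<le> (SUP f\<in>dual_unit_ball norm. \<Sum>k<N. \<bar>f (z k)\<bar>\<^sup>2)"
    by (rule cSUP_upper)
  then have "(norm y)\<^sup>2 * (\<Sum>k<N. \<bar>u \<bullet> z k\<bar>\<^sup>2)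
      \<le> (norm y)\<^sup>2 * (SUP f\<in>dual_unit_ball norm. \<Sum>k<N. \<bar>f (z k)\<bar>\<^sup>2)"
    by (intro mult_left_mono) auto
  moreover have "(norm y)\<^sup>2 * (\<Sum>k<N. \<bar>u \<bullet> z k\<bar>\<^sup>2) = (\<Sum>k<N. (y \<bullet> z k)\<^sup>2)"
    using False by (simp add: sum_distrib_left u_def power_mult_distrib field_simps)
  ultimately show ?thesis by simp
qed simp

lemma SUP_weak_sum_le:
  fixes z :: "nat \<Rightarrow> 'a::euclidean_space"
  assumes "\<And>y. (\<Sum>k<N. (y \<bullet> z k)\<^sup>2) \<le> l * (norm y)\<^sup>2" "0 \<le> l"
  shows "(SUP f\<in>dual_unit_ball norm. \<Sum>k<N. \<bar>f (z k)\<bar>\<^sup>2) \<le> l"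
  unfolding dual_unit_ball_norm image_image
proof (rule cSUP_least)
  fix y :: 'a assume "y \<in> cball 0 1"
  then have "l * (norm y)\<^sup>2 \<le> l"
    using assms(2) by (simp add: mult_left_le power_le_one)
  then show "(\<Sum>k<N. \<bar>y \<bullet> z k\<bar>\<^sup>2) \<le> l"
    using assms(1)[of y] by simp
qed simp

section \<open>Pietsch domination\<close>

definition outer :: "real ^ 'n \<Rightarrow> real ^ 'n ^ 'n" where
  "outer z = (\<chi> i j. z $ i * z $ j)"

lemma inner_outer: "M \<bullet> outer z = z \<bullet> (M *v z)"
  unfolding quadratic_form_eq_sum by (simp add: inner_vec_def outer_def algebra_simps)

lemma inner_outer_outer: "outer y \<bullet> outer z = (y \<bullet> z)\<^sup>2"
  by (simp add: outer_def inner_vec_def power2_eq_square sum_product algebra_simps)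

lemma symmetric_part:
  fixes M :: "real ^ 'n ^ 'n"
  obtains P where "symmetric_matrix P" "trace P = trace M" "\<And>x. x \<bullet> (P *v x) = x \<bullet> (M *v x)"
proof -
  define P where "P = (1 / 2) *\<^sub>R (M + transpose M)"
  have "symmetric_matrix P"
    by (simp add: P_def symmetric_matrix_def transpose_def vec_eq_iff)
  moreover have "trace P = trace M"
    by (simp add: P_def trace_def transpose_def)
  moreover have "x \<bullet> (transpose M *v x) = x \<bullet> (M *v x)" for x
    by (metis dot_lmul_matrix inner_commute transpose_matrix_vector)
  then have "x \<bullet> (P *v x) = x \<bullet> (M *v x)" for x
    unfolding P_def inner_outer[symmetric] by (simp add: inner_left_distrib)
  ultimately show ?thesis by (rule that)
qed

text \<open>
  Let \<open>A\<close> be the cone of pairs \<open>(\<Sum> z\<^sub>k z\<^sub>k\<^sup>*, \<Sum> \<parallel>S z\<^sub>k\<parallel>\<^sup>2)\<close>, and \<open>B\<close> the cone of pairs \<open>(M, s)\<close> where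
  \<open>s\<close> exceeds \<open>c\<^sup>2\<close> times an upper bound \<open>l \<ge> 0\<close> of the Rayleigh quotient of \<open>M\<close>.  The weak sum of
  \<open>(z\<^sub>k)\<close> is the largest eigenvalue of \<open>\<Sum> z\<^sub>k z\<^sub>k\<^sup>*\<close>, so the 2-summing inequality says that the cones
  are disjoint.  A separating functional has the form \<open>(M, s) \<mapsto> Q \<bullet> M - r s\<close> with \<open>r > 0\<close>.  Its sign
  on the generators of \<open>A\<close> is domination by \<open>Q / r\<close>, and its sign at \<open>(I, s)\<close> for \<open>s > c\<^sup>2\<close> bounds the
  trace.
\<close>

lemma pietsch_domination:
  fixes S :: "real ^ 'm \<Rightarrow> 'b::real_vector"
  assumes bound: "two_summing_bound norm nF S c"
    and homogeneous: "\<And>t z. nF (S (t *\<^sub>R z)) = \<bar>t\<bar> * nF (S z)"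
  obtains P where "pos_semidef P" "trace P \<le> c\<^sup>2" "\<And>z. (nF (S z))\<^sup>2 \<le> z \<bullet> (P *v z)"
proof -
  define A :: "((real ^ 'm ^ 'm) \<times> real) set" where
    "A = {p. \<exists>(N::nat) z. p = (\<Sum>k<N. (outer (z k), (nF (S (z k)))\<^sup>2))}"
  define B :: "((real ^ 'm ^ 'm) \<times> real) set" where
    "B = {(M, s). \<exists>l\<ge>0. (\<forall>x. x \<bullet> (M *v x) \<le> l * (norm x)\<^sup>2) \<and> c\<^sup>2 * l < s}"
  have A_single: "(outer z, (nF (S z))\<^sup>2) \<in> A" for z
    unfolding A_def by (intro CollectI exI[of _ 1] exI[of _ "\<lambda>_. z"]) simp
  have A_zero: "0 \<in> A"
    unfolding A_def by (intro CollectI exI[of _ 0]) simp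
  have A_scale: "t *\<^sub>R p \<in> A" if "p \<in> A" "0 \<le> t" for t p
  proof -
    obtain N and z where p: "p = (\<Sum>k<(N::nat). (outer (z k), (nF (S (z k)))\<^sup>2))"
      using \<open>p \<in> A\<close> by (auto simp: A_def)
    have "outer (sqrt t *\<^sub>R x) = t *\<^sub>R outer x" for x :: "real ^ 'm"
      using \<open>0 \<le> t\<close> by (simp add: outer_def vec_eq_iff algebra_simps)
    moreover have "(nF (S (sqrt t *\<^sub>R x)))\<^sup>2 = t * (nF (S x))\<^sup>2" for x
      using \<open>0 \<le> t\<close> by (simp add: homogeneous power_mult_distrib)
    ultimately have "t *\<^sub>R p
        = (\<Sum>k<N. (outer (sqrt t *\<^sub>R z k), (nF (S (sqrt t *\<^sub>R z k)))\<^sup>2))"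
      by (simp add: p scaleR_sum_right)
    then show ?thesis
      unfolding A_def by (intro CollectI exI[of _ N] exI[of _ "\<lambda>k. sqrt t *\<^sub>R z k"])
  qed
  have A_add: "p + q \<in> A" if "p \<in> A" "q \<in> A" for p q
  proof -
    let ?g = "\<lambda>x. (outer x, (nF (S x))\<^sup>2)"
    obtain N and z where p: "p = (\<Sum>k<(N::nat). ?g (z k))"
      using \<open>p \<in> A\<close> by (auto simp: A_def)
    obtain N' and z' where q: "q = (\<Sum>k<(N'::nat). ?g (z' k))"
      using \<open>q \<in> A\<close> by (auto simp: A_def)
    define w where "w k = (if k < N then z k else z' (k - N))" for k
    have "(\<Sum>k<N + n. ?g (w k)) = p + (\<Sum>k<n. ?g (z' k))" for n
      by (induction n) (simp_all add: p w_def add.assoc)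
    then have "p + q = (\<Sum>k<N + N'. ?g (w k))"
      by (simp add: q)
    then show ?thesis
      unfolding A_def by (intro CollectI exI[of _ "N + N'"] exI[of _ w])
  qed
  have "convex A"
    by (intro convexI A_add A_scale)
  moreover have "convex B"
  proof (intro convexI)
    fix p q and u v :: real
    assume pq: "p \<in> B" "q \<in> B" and uv: "0 \<le> u" "0 \<le> v" "u + v = 1"
    obtain M s l where p: "p = (M, s)" "0 \<le> l" "\<And>x. x \<bullet> (M *v x) \<le> l * (norm x)\<^sup>2" "c\<^sup>2 * l < s"
      using pq(1) by (auto simp: B_def)
    obtain M' s' l' where q: "q = (M', s')" "0 \<le> l'" "\<And>x. x \<bullet> (M' *v x) \<le> l' * (norm x)\<^sup>2"
      "c\<^sup>2 * l' < s'"
      using pq(2) by (auto simp: B_def)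
    have "x \<bullet> ((u *\<^sub>R M + v *\<^sub>R M') *v x) \<le> (u * l + v * l') * (norm x)\<^sup>2" for x
    proof -
      have "x \<bullet> ((u *\<^sub>R M + v *\<^sub>R M') *v x) = u * (x \<bullet> (M *v x)) + v * (x \<bullet> (M' *v x))"
        unfolding inner_outer[symmetric] by (simp add: inner_left_distrib)
      also have "\<dots> \<le> u * (l * (norm x)\<^sup>2) + v * (l' * (norm x)\<^sup>2)"
        by (intro add_mono mult_left_mono p q uv)
      finally show ?thesis by (simp add: algebra_simps)
    qed
    moreover have "c\<^sup>2 * (u * l + v * l') < u * s + v * s'"
      using convex_bound_lt[of "c\<^sup>2 * l - s" 0 "c\<^sup>2 * l' - s'" u v] p(4) q(4) uv
      by (simp add: algebra_simps)
    ultimately show "u *\<^sub>R p + v *\<^sub>R q \<in> B"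
      unfolding B_def p(1) q(1) using p(2) q(2) uv
      by (auto intro!: exI[of _ "u * l + v * l'"])
  qed
  moreover have "A \<noteq> {}"
    using A_zero by blast
  moreover have B_zero: "(0, 1) \<in> B"
    by (auto simp: B_def intro!: exI[of _ 0])
  then have "B \<noteq> {}" by blast
  moreover have "B \<inter> A = {}"
  proof (rule ccontr)
    assume "B \<inter> A \<noteq> {}"
    then obtain N and z where inB: "(\<Sum>k<(N::nat). (outer (z k), (nF (S (z k)))\<^sup>2)) \<in> B"
      unfolding A_def by blast
    then obtain l where l: "0 \<le> l" "\<And>x. x \<bullet> ((\<Sum>k<N. outer (z k)) *v x) \<le> l * (norm x)\<^sup>2"
      "c\<^sup>2 * l < (\<Sum>k<N. (nF (S (z k)))\<^sup>2)"
      by (auto simp: B_def sum_prod)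
    have "(\<Sum>k<N. (x \<bullet> z k)\<^sup>2) \<le> l * (norm x)\<^sup>2" for x
      using l(2)[of x] unfolding inner_outer[symmetric]
      by (simp add: inner_sum_left inner_outer_outer inner_commute[of x])
    then have "(SUP f\<in>dual_unit_ball norm. \<Sum>k<N. \<bar>f (z k)\<bar>\<^sup>2) \<le> l"
      using l(1) by (rule SUP_weak_sum_le)
    then have "(\<Sum>k<N. (nF (S (z k)))\<^sup>2) \<le> c\<^sup>2 * l"
      using bound unfolding two_summing_bound_def
      by (meson mult_left_mono order_trans zero_le_power2)
    with l(3) show False by simp
  qed
  ultimately obtain a b where "a \<noteq> 0" and aB: "\<And>p. p \<in> B \<Longrightarrow> a \<bullet> p \<le> b"
    and aA: "\<And>p. p \<in> A \<Longrightarrow> b \<le> a \<bullet> p"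
    using separating_hyperplane_sets[of B A] by metis
  have "b \<le> 0"
    using aA[OF A_zero] by simp
  \<comment> \<open>A linear functional bounded below on a cone is nonnegative there: a negative value could be
    scaled down to \<open>b - 1\<close>.\<close>
  have A_nonneg: "0 \<le> a \<bullet> p" if "p \<in> A" for p
  proof (rule ccontr)
    assume neg: "\<not> 0 \<le> a \<bullet> p"
    have "b \<le> a \<bullet> (((b - 1) / (a \<bullet> p)) *\<^sub>R p)"
      using neg \<open>b \<le> 0\<close> by (intro aA A_scale that) (simp add: divide_nonpos_neg)
    then show False using neg by simp
  qed
  obtain Q r' where a: "a = (Q, r')" by (cases a)
  define r where "r = - r'"
  have B_le: "Q \<bullet> M \<le> r * s" if "(M, s) \<in> B" for M s
    using aB[OF that] \<open>b \<le> 0\<close> by (simp add: a r_def)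
  have "0 \<le> r" using B_le[OF B_zero] by simp
  \<comment> \<open>The hyperplane is not vertical: every matrix is the first component of some element of \<open>B\<close>, in
    particular \<open>Q\<close>, so \<open>r = 0\<close> would give \<open>Q \<bullet> Q \<le> 0\<close>.\<close>
  moreover have "r \<noteq> 0"
  proof
    assume "r = 0"
    define l where "l = onorm ((*v) Q)"
    have "0 \<le> l"
      unfolding l_def by (intro onorm_pos_le) simp
    have "x \<bullet> (Q *v x) \<le> l * (norm x)\<^sup>2" for x
    proof -
      have "x \<bullet> (Q *v x) \<le> norm x * norm (Q *v x)"
        by (rule norm_cauchy_schwarz)
      also have "\<dots> \<le> norm x * (l * norm x)"
        unfolding l_def by (intro mult_left_mono onorm) auto
      finally show ?thesis by (simp add: power2_eq_square algebra_simps)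
    qed
    then have "(Q, c\<^sup>2 * l + 1) \<in> B"
      using \<open>0 \<le> l\<close> by (auto simp: B_def)
    from B_le[OF this] \<open>r = 0\<close> have "Q \<bullet> Q = 0"
      using inner_ge_zero[of Q] by simp
    then have "Q = 0"
      by (simp only: inner_eq_zero_iff)
    with \<open>a \<noteq> 0\<close> \<open>r = 0\<close> show False by (simp add: a r_def zero_prod_def)
  qed
  ultimately have "r > 0" by simp
  \<comment> \<open>The separating \<open>Q\<close> need not be symmetric; its symmetric part has the same quadratic form.\<close>
  obtain P where P: "symmetric_matrix P" "trace P = trace ((1 / r) *\<^sub>R Q)"
    "\<And>x. x \<bullet> (P *v x) = x \<bullet> (((1 / r) *\<^sub>R Q) *v x)"
    using symmetric_part[of "(1 / r) *\<^sub>R Q"] by metis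
  have dominate: "(nF (S z))\<^sup>2 \<le> z \<bullet> (P *v z)" for z
  proof -
    have "r * (nF (S z))\<^sup>2 \<le> Q \<bullet> outer z"
      using A_nonneg[OF A_single[of z]] by (simp add: a r_def)
    then show ?thesis
      using \<open>r > 0\<close> unfolding P(3) unfolding inner_outer[symmetric] by (simp add: field_simps)
  qed
  have "trace Q \<le> r * c\<^sup>2"
  proof (rule field_le_epsilon)
    fix e :: real assume "e > 0"
    have "(mat 1, c\<^sup>2 + e / r) \<in> B"
      using \<open>e > 0\<close> \<open>r > 0\<close> by (auto simp: B_def dot_square_norm intro!: exI[of _ 1])
    from B_le[OF this] have "Q \<bullet> mat 1 \<le> r * c\<^sup>2 + e"
      using \<open>r > 0\<close> by (simp add: algebra_simps)
    moreover have "Q \<bullet> mat 1 = trace Q"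
      by (simp add: inner_vec_def mat_def trace_def if_distrib cong: if_cong)
    ultimately show "trace Q \<le> r * c\<^sup>2 + e" by simp
  qed
  then have "trace P \<le> c\<^sup>2"
    using \<open>r > 0\<close> unfolding P(2) by (simp add: trace_def sum_divide_distrib[symmetric] field_simps)
  moreover have "pos_semidef P"
    unfolding pos_semidef_def using P(1) dominate order_trans zero_le_power2 by blast
  ultimately show ?thesis
    using dominate that by blast
qed

text \<open>
  The image of the unit ball under \<open>B\<^sup>*\<close> is compact and convex, and its support function at \<open>z\<close> is
  \<open>\<parallel>B z\<parallel>\<close>; a vector whose pairing with every \<open>z\<close> stays below that lies in the set.
\<close>

lemma dominated_functional_factors:
  fixes B :: "real ^ 'm ^ 'k" and t :: "real ^ 'm"
  assumes "\<And>z. \<bar>t \<bullet> z\<bar> \<le> norm (B *v z)"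
  obtains u where "norm u \<le> 1" "t = transpose B *v u"
proof (rule ccontr)
  define C where "C = (\<lambda>u. transpose B *v u) ` cball 0 1"
  assume "\<not> thesis"
  have "t \<notin> C"
  proof
    assume "t \<in> C"
    then obtain u where "u \<in> cball 0 1" "t = transpose B *v u"
      unfolding C_def by blast
    with that[of u] \<open>\<not> thesis\<close> show False
      unfolding mem_cball_0 by blast
  qed
  moreover have "compact C"
    unfolding C_def by (intro compact_continuous_image linear_continuous_on) auto
  moreover have "convex C"
    unfolding C_def by (intro convex_linear_image) auto
  ultimately obtain z b where z: "z \<bullet> t < b" "\<And>x. x \<in> C \<Longrightarrow> z \<bullet> x > b"
    using separating_hyperplane_closed_point[of C t] compact_imp_closed by blast
  \<comment> \<open>The minimizer of \<open>z \<bullet> B\<^sup>* u\<close> over the unit ball; division by zero gives \<open>u = 0\<close> if \<open>B z = 0\<close>.\<close>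
  define u where "u = - (B *v z) /\<^sub>R norm (B *v z)"
  have "norm u = norm (B *v z) / norm (B *v z)"
    by (simp add: u_def divide_inverse)
  then have "norm u \<le> 1"
    by (simp only: divide_self_if) simp
  then have "b < z \<bullet> (transpose B *v u)"
    by (intro z) (auto simp: C_def)
  also have "z \<bullet> (transpose B *v u) = (B *v z) \<bullet> u"
    by (metis dot_lmul_matrix inner_commute transpose_matrix_vector)
  also have "\<dots> = - ((norm (B *v z))\<^sup>2 / norm (B *v z))"
    by (simp add: u_def dot_square_norm divide_inverse mult.commute)
  also have "\<dots> = - norm (B *v z)"
    by (simp add: power2_eq_square)
  finally show False
    using z(1) assms[of z] by (simp add: inner_commute)
qed

section \<open>Comparison of the three quantities\<close>

lemma transpose_mult_component: "(transpose T *v x) $ j = column j T \<bullet> (x :: real ^ 'm)"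
  for T :: "real ^ 'n ^ 'm"
  by (simp add: matrix_vector_mult_def transpose_def column_def inner_vec_def)

text \<open>
  By Cauchy-Schwarz in the inner space, each entry of \<open>T\<^sup>* x\<close> is at most \<open>\<parallel>T\<^sub>2\<parallel>\<close> times
  \<open>\<parallel>T\<^sub>1\<^sup>* x\<parallel>\<close>.  Each column of \<open>T\<^sub>1\<close> is a functional, so its sum of squares over \<open>(z\<^sub>k)\<close> is at most
  its squared norm times the weak sum; the squared column norms add up to \<open>\<parallel>T\<^sub>1\<parallel>\<^sub>F\<^sup>2\<close>.
\<close>

lemma two_summing_bound_factorization:
  fixes T :: "real ^ 'n ^ 'm"
  assumes T: "factorizes T d T1 T2"
  shows "two_summing_bound norm infnorm (\<lambda>x. transpose T *v x)
    (frobenius_norm d T1 * opnorm_l1_l2 d T2)"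
  unfolding two_summing_bound_def
proof (intro allI)
  fix N and z :: "nat \<Rightarrow> real ^ 'm"
  define a :: "nat \<Rightarrow> real ^ 'm" where "a l = (\<chi> i. T1 i l)" for l
  let ?o = "opnorm_l1_l2 d T2"
  let ?s = "SUP f\<in>dual_unit_ball norm. \<Sum>k<N. \<bar>f (z k)\<bar>\<^sup>2"
  have pointwise: "(infnorm (transpose T *v x))\<^sup>2 \<le> ?o\<^sup>2 * (\<Sum>l<d. (a l \<bullet> x)\<^sup>2)" for x
  proof -
    have "\<bar>(transpose T *v x) $ j\<bar> \<le> ?o * L2_set (\<lambda>l. a l \<bullet> x) {..<d}" for j
    proof -
      have "(transpose T *v x) $ j = (\<Sum>i\<in>UNIV. \<Sum>l<d. T1 i l * T2 l j * x $ i)"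
        using T by (simp add: factorizes_def matrix_vector_mult_def transpose_def sum_distrib_right)
      also have "\<dots> = (\<Sum>l<d. T2 l j * (a l \<bullet> x))"
        by (subst sum.swap) (simp add: a_def inner_vec_def sum_distrib_left algebra_simps)
      finally have "\<bar>(transpose T *v x) $ j\<bar> \<le> (\<Sum>l<d. \<bar>T2 l j\<bar> * \<bar>a l \<bullet> x\<bar>)"
        by (metis (no_types, lifting) abs_mult sum.cong sum_abs)
      also have "\<dots> \<le> L2_set (\<lambda>l. T2 l j) {..<d} * L2_set (\<lambda>l. a l \<bullet> x) {..<d}"
        by (rule L2_set_mult_ineq)
      also have "\<dots> \<le> ?o * L2_set (\<lambda>l. a l \<bullet> x) {..<d}"
        by (intro mult_right_mono column_le_opnorm_l1_l2 L2_set_nonneg)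
      finally show ?thesis .
    qed
    then have "infnorm (transpose T *v x) \<le> ?o * L2_set (\<lambda>l. a l \<bullet> x) {..<d}"
      by (simp only: infnorm_le_iff_cart) blast
    then have "(infnorm (transpose T *v x))\<^sup>2 \<le> (?o * L2_set (\<lambda>l. a l \<bullet> x) {..<d})\<^sup>2"
      by (intro power_mono infnorm_pos_le)
    then show ?thesis
      by (simp add: power_mult_distrib L2_set_def sum_nonneg)
  qed
  have "(\<Sum>k<N. (infnorm (transpose T *v z k))\<^sup>2) \<le> (\<Sum>k<N. ?o\<^sup>2 * (\<Sum>l<d. (a l \<bullet> z k)\<^sup>2))"
    by (intro sum_mono pointwise)
  also have "\<dots> = ?o\<^sup>2 * (\<Sum>l<d. \<Sum>k<N. (a l \<bullet> z k)\<^sup>2)"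
    by (subst sum.swap) (simp add: sum_distrib_left)
  also have "\<dots> \<le> ?o\<^sup>2 * (\<Sum>l<d. (norm (a l))\<^sup>2 * ?s)"
    by (intro mult_left_mono sum_mono weak_sum_le_SUP) auto
  also have "\<dots> = ?o\<^sup>2 * (\<Sum>l<d. (norm (a l))\<^sup>2) * ?s"
    by (simp add: sum_distrib_right)
  also have "(\<Sum>l<d. (norm (a l))\<^sup>2) = (frobenius_norm d T1)\<^sup>2"
  proof -
    have "(\<Sum>l<d. (norm (a l))\<^sup>2) = (\<Sum>l<d. \<Sum>i\<in>UNIV. (T1 i l)\<^sup>2)"
      by (simp add: power2_norm_eq_inner inner_vec_def a_def flip: power2_eq_square)
    also have "\<dots> = (\<Sum>i\<in>UNIV. \<Sum>l<d. (T1 i l)\<^sup>2)"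
      by (rule sum.swap)
    finally show ?thesis
      by (simp add: frobenius_norm_def sum_nonneg)
  qed
  finally show "(\<Sum>k<N. (infnorm (transpose T *v z k))\<^sup>2)
      \<le> (frobenius_norm d T1 * ?o)\<^sup>2 * ?s"
    by (simp add: power_mult_distrib algebra_simps)
qed

lemma factorization_of_two_summing_bound:
  fixes T :: "real ^ 'n ^ 'm"
  assumes bound: "two_summing_bound norm infnorm (\<lambda>x. transpose T *v x) c" and "0 < c"
  obtains d T1 T2 where "factorizes T d T1 T2" "frobenius_norm d T1 * opnorm_l1_l2 d T2 \<le> c"
proof -
  obtain P :: "real ^ 'm ^ 'm" where P: "pos_semidef P" "trace P \<le> c\<^sup>2"
    "\<And>z. (infnorm (transpose T *v z))\<^sup>2 \<le> z \<bullet> (P *v z)"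
  proof (rule pietsch_domination[OF bound])
    show "infnorm (transpose T *v (t *\<^sub>R z)) = \<bar>t\<bar> * infnorm (transpose T *v z)" for t z
      by (simp only: matrix_vector_mult_scaleR infnorm_mul)
  qed (rule that)
  obtain v :: "'m \<Rightarrow> 'm \<Rightarrow> real" where v: "\<And>i j. P $ i $ j = (\<Sum>k\<in>UNIV. v k i * v k j)"
    using pos_semidef_gram[OF P(1)] by metis
  define V :: "real ^ 'm ^ 'm" where "V = (\<chi> k i. v k i)"
  have "P = transpose V ** V"
    by (simp add: vec_eq_iff v V_def matrix_matrix_mult_def transpose_def)
  then have form: "z \<bullet> (P *v z) = (norm (V *v z))\<^sup>2" for z
    by (metis dot_lmul_matrix inner_commute matrix_vector_mul_assoc power2_norm_eq_inner
        transpose_matrix_vector)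
  have "\<exists>u :: real ^ 'm. norm u \<le> 1 \<and> column j T = transpose V *v u" for j
  proof -
    have "\<bar>column j T \<bullet> z\<bar> \<le> norm (V *v z)" for z
    proof -
      have "\<bar>column j T \<bullet> z\<bar> \<le> infnorm (transpose T *v z)"
        unfolding transpose_mult_component[symmetric] by (rule component_le_infnorm_cart)
      also have "\<dots> \<le> norm (V *v z)"
        using P(3)[of z] unfolding form by (rule power2_le_imp_le) simp
      finally show ?thesis .
    qed
    then obtain u where "norm u \<le> 1" "column j T = transpose V *v u"
      by (rule dominated_functional_factors)
    then show ?thesis by blast
  qed
  then obtain u :: "'n \<Rightarrow> real ^ 'm" where u: "\<And>j. norm (u j) \<le> 1"
    "\<And>j. column j T = transpose V *v u j"
    by metis
  have "T $ i $ j = (\<Sum>k\<in>UNIV. v k i * u j $ k)" for i j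
  proof -
    have "T $ i $ j = column j T $ i" by (simp add: column_def)
    then show ?thesis
      unfolding u(2) by (simp add: matrix_vector_mult_def transpose_def V_def del: transpose_matrix_vector)
  qed
  moreover have "(\<Sum>k\<in>UNIV. (u j $ k)\<^sup>2) \<le> 1" for j
    using power_le_one[OF norm_ge_zero u(1), of j 2]
    by (simp add: power2_norm_eq_inner inner_vec_def flip: power2_eq_square)
  ultimately obtain d T1 T2 where "factorizes T d T1 T2"
    and le: "frobenius_norm d T1 * opnorm_l1_l2 d T2
      \<le> sqrt ((\<Sum>i\<in>UNIV. \<Sum>k\<in>UNIV. (v k i)\<^sup>2) * 1)"
    using finite_type_factorization[of T "\<lambda>i k. v k i" "\<lambda>k j. u j $ k" 1] by blast
  moreover have "(\<Sum>i\<in>UNIV. \<Sum>k\<in>UNIV. (v k i)\<^sup>2) = trace P"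
    by (simp add: trace_def v power2_eq_square)
  then have "sqrt ((\<Sum>i\<in>UNIV. \<Sum>k\<in>UNIV. (v k i)\<^sup>2) * 1) \<le> c"
    using P(2) \<open>0 < c\<close> by (simp add: real_le_lsqrt)
  ultimately show ?thesis
    using that order_trans by blast
qed

text \<open>
  Splitting the Gram vectors of the block matrix makes the trace of \<open>W\<^sub>1\<close> and the diagonal of \<open>W\<^sub>2\<close>
  the squared norms of the factors, and a geometric mean is at most the maximum.
\<close>

lemma factorization_of_block:
  fixes T :: "real ^ 'n ^ 'm"
  assumes psd: "pos_semidef (block_matrix W1 T (transpose T) W2)"
  obtains d T1 T2 where "factorizes T d T1 T2"
    "frobenius_norm d T1 * opnorm_l1_l2 d T2 \<le> max (trace W1) (infnorm (diag_vec W2))"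
proof -
  obtain v :: "'m + 'n \<Rightarrow> 'm + 'n \<Rightarrow> real" where
    v: "\<And>i j. block_matrix W1 T (transpose T) W2 $ i $ j = (\<Sum>k\<in>UNIV. v k i * v k j)"
    using pos_semidef_gram[OF psd] by blast
  have W1: "W1 $ i $ j = (\<Sum>k\<in>UNIV. v k (Inl i) * v k (Inl j))" for i j
    using v[of "Inl i" "Inl j"] by (simp add: block_matrix_def)
  have W2: "W2 $ i $ j = (\<Sum>k\<in>UNIV. v k (Inr i) * v k (Inr j))" for i j
    using v[of "Inr i" "Inr j"] by (simp add: block_matrix_def)
  have T: "T $ i $ j = (\<Sum>k\<in>UNIV. v k (Inl i) * v k (Inr j))" for i j
    using v[of "Inl i" "Inr j"] by (simp add: block_matrix_def)
  let ?b = "infnorm (diag_vec W2)"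
  let ?m = "max (trace W1) ?b"
  have "(\<Sum>k\<in>UNIV. (v k (Inr j))\<^sup>2) \<le> ?b" for j
  proof -
    have "(\<Sum>k\<in>UNIV. (v k (Inr j))\<^sup>2) = diag_vec W2 $ j"
      by (simp add: diag_vec_def W2 power2_eq_square)
    then show ?thesis
      using component_le_infnorm_cart[of "diag_vec W2" j] by linarith
  qed
  from finite_type_factorization[OF T this] obtain d T1 T2 where "factorizes T d T1 T2"
    and le: "frobenius_norm d T1 * opnorm_l1_l2 d T2
      \<le> sqrt ((\<Sum>i\<in>UNIV. \<Sum>k\<in>UNIV. (v k (Inl i))\<^sup>2) * ?b)"
    by blast
  have tr: "trace W1 = (\<Sum>i\<in>UNIV. \<Sum>k\<in>UNIV. (v k (Inl i))\<^sup>2)"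
    by (simp add: trace_def W1 power2_eq_square)
  have "trace W1 * ?b \<le> ?m * ?m"
    by (intro mult_mono) (auto simp: infnorm_pos_le le_max_iff_disj)
  moreover have "0 \<le> ?m"
    by (simp add: infnorm_pos_le le_max_iff_disj)
  ultimately have "sqrt (trace W1 * ?b) \<le> ?m"
    by (intro real_le_lsqrt) (simp_all add: power2_eq_square)
  with le show ?thesis
    using that \<open>factorizes T d T1 T2\<close> unfolding tr[symmetric] by fastforce
qed

text \<open>
  Rescaling the factors by \<open>s\<close> and \<open>1 / s\<close> makes their norms equal, so that both squares coincide
  with the product.  This is impossible if one norm vanishes, but then \<open>T = 0\<close> and the zero matrices
  serve; the two scalars \<open>s\<close> and \<open>t\<close> cover both cases.
\<close>

lemma block_of_factorization:
  fixes T :: "real ^ 'n ^ 'm"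
  assumes T: "factorizes T d T1 T2"
  obtains W1 W2 where "symmetric_matrix W1" "symmetric_matrix W2"
    "pos_semidef (block_matrix W1 T (transpose T) W2)"
    "max (trace W1) (infnorm (diag_vec W2)) \<le> frobenius_norm d T1 * opnorm_l1_l2 d T2"
proof -
  note construct = that
  let ?f = "frobenius_norm d T1" and ?o = "opnorm_l1_l2 d T2"
  have f2: "(\<Sum>i\<in>UNIV. \<Sum>k<d. (T1 i k)\<^sup>2) = ?f\<^sup>2"
    by (simp add: frobenius_norm_def sum_nonneg)
  have o2: "(\<Sum>k<d. (T2 k j)\<^sup>2) \<le> ?o\<^sup>2" for j
    using power_mono[OF column_le_opnorm_l1_l2[of T2 j d] L2_set_nonneg, of 2]
    by (simp add: L2_set_def sum_nonneg)
  have nonneg: "0 \<le> ?f" "0 \<le> ?o"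
    by (rule frobenius_norm_nonneg opnorm_l1_l2_nonneg)+
  have block: thesis
    if s: "\<And>i j. T $ i $ j = (\<Sum>k<d. (s * T1 i k) * (t * T2 k j))"
      and "s\<^sup>2 * ?f\<^sup>2 \<le> ?f * ?o" "t\<^sup>2 * ?o\<^sup>2 \<le> ?f * ?o" for s t
  proof -
    define W1 :: "real ^ 'm ^ 'm" where "W1 = (\<chi> i j. \<Sum>k<d. (s * T1 i k) * (s * T1 j k))"
    define W2 :: "real ^ 'n ^ 'n" where "W2 = (\<chi> i j. \<Sum>k<d. (t * T2 k i) * (t * T2 k j))"
    define v :: "nat \<Rightarrow> 'm + 'n \<Rightarrow> real" where
      "v k i = (case i of Inl i \<Rightarrow> s * T1 i k | Inr j \<Rightarrow> t * T2 k j)" for k i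
    have "pos_semidef (block_matrix W1 T (transpose T) W2)"
    proof (rule pos_semidef_gramI)
      show "block_matrix W1 T (transpose T) W2 $ i $ j = (\<Sum>k<d. v k i * v k j)" for i j
        by (simp add: block_matrix_def v_def W1_def W2_def s transpose_def mult.commute
            split: sum.split)
    qed
    moreover have "trace W1 = s\<^sup>2 * ?f\<^sup>2"
      unfolding f2[symmetric]
      by (simp add: trace_def W1_def sum_distrib_left power2_eq_square algebra_simps)
    moreover have "infnorm (diag_vec W2) \<le> ?f * ?o"
      unfolding infnorm_le_iff_cart
    proof
      fix j
      have "diag_vec W2 $ j = t\<^sup>2 * (\<Sum>k<d. (T2 k j)\<^sup>2)"
        by (simp add: diag_vec_def W2_def sum_distrib_left power2_eq_square algebra_simps)
      moreover have "t\<^sup>2 * (\<Sum>k<d. (T2 k j)\<^sup>2) \<le> t\<^sup>2 * ?o\<^sup>2"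
        by (intro mult_left_mono o2) simp
      ultimately show "\<bar>diag_vec W2 $ j\<bar> \<le> ?f * ?o"
        using that(3) by (simp add: sum_nonneg)
    qed
    moreover have "symmetric_matrix W1" "symmetric_matrix W2"
      by (simp_all add: symmetric_matrix_def transpose_def W1_def W2_def mult.commute vec_eq_iff)
    ultimately show ?thesis
      using that(2) by (intro construct[of W1 W2]) auto
  qed
  show ?thesis
  proof (cases "?f = 0 \<or> ?o = 0")
    case True
    have "T1 i k * T2 k j = 0" if "k < d" for i j k
      using True
    proof
      assume "?f = 0"
      then have "(\<Sum>i\<in>UNIV. \<Sum>k<d. (T1 i k)\<^sup>2) = 0" using f2 by simp
      then have "T1 i k = 0"
        using that by (simp add: sum_nonneg_eq_0_iff sum_nonneg)
      then show ?thesis by simp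
    next
      assume "?o = 0"
      then have "(\<Sum>k<d. (T2 k j)\<^sup>2) = 0"
        using o2[of j] by (simp add: order_antisym sum_nonneg)
      then have "T2 k j = 0"
        using that by (simp add: sum_nonneg_eq_0_iff)
      then show ?thesis by simp
    qed
    then have "T $ i $ j = (\<Sum>k<d. (0 * T1 i k) * (0 * T2 k j))" for i j
      using T by (auto simp: factorizes_def intro!: sum.neutral)
    then show ?thesis
      using nonneg by (intro block[of 0 0]) auto
  next
    case False
    then have pos: "?f > 0" "?o > 0" using nonneg by auto
    define s where "s = sqrt (?o / ?f)"
    have "s > 0" using pos by (simp add: s_def)
    have s2: "s\<^sup>2 = ?o / ?f" using pos by (simp add: s_def)
    show ?thesis
    proof (rule block[of s "1 / s"])
      show "T $ i $ j = (\<Sum>k<d. (s * T1 i k) * (1 / s * T2 k j))" for i j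
        using T \<open>s > 0\<close> by (simp add: factorizes_def)
      show "s\<^sup>2 * ?f\<^sup>2 \<le> ?f * ?o" "(1 / s)\<^sup>2 * ?o\<^sup>2 \<le> ?f * ?o"
        unfolding power_divide s2 using pos by (simp_all add: power2_eq_square)
    qed
  qed
qed

theorem mainTheorem11:
  fixes T :: "real ^ 'n ^ 'm"
  shows "two_summing_norm (norm :: real ^ 'm \<Rightarrow> real) (infnorm :: real ^ 'n \<Rightarrow> real)
           (\<lambda>x. transpose T *v x)
         = Inf {ereal (frobenius_norm d T1 * opnorm_l1_l2 d T2) | d T1 T2. factorizes T d T1 T2}
    \<and> two_summing_norm (norm :: real ^ 'm \<Rightarrow> real) (infnorm :: real ^ 'n \<Rightarrow> real)
           (\<lambda>x. transpose T *v x)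
         = Inf {ereal (max (trace W1) (infnorm (diag_vec W2)))
                | (W1 :: real ^ 'm ^ 'm) (W2 :: real ^ 'n ^ 'n).
                  symmetric_matrix W1 \<and> symmetric_matrix W2 \<and>
                  pos_semidef (block_matrix W1 T (transpose T) W2)}"
    (is "?pi = Inf ?F \<and> _ = Inf ?W")
proof -
  let ?S = "\<lambda>x. transpose T *v x"
  let ?C = "{ereal c | c. 0 < c \<and> two_summing_bound norm infnorm ?S c}"
  have "?pi \<le> Inf ?F"
  proof (rule Inf_greatest)
    fix e assume "e \<in> ?F"
    then obtain d T1 T2 where T: "factorizes T d T1 T2"
      and e: "e = ereal (frobenius_norm d T1 * opnorm_l1_l2 d T2)"
      by blast
    let ?p = "frobenius_norm d T1 * opnorm_l1_l2 d T2"
    have p: "0 \<le> ?p"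
      by (intro mult_nonneg_nonneg frobenius_norm_nonneg opnorm_l1_l2_nonneg)
    \<comment> \<open>The constants competing in the 2-summing norm are positive while \<open>?p\<close> may vanish, hence the
      slack \<open>r\<close>.\<close>
    have "?pi \<le> ereal ?p + ereal r" if "0 < r" for r
    proof -
      have "two_summing_bound norm infnorm ?S (?p + r)"
        unfolding two_summing_bound_def
      proof (intro allI)
        fix N and z :: "nat \<Rightarrow> real ^ 'm"
        let ?s = "SUP f\<in>dual_unit_ball norm. \<Sum>k<N. \<bar>f (z k)\<bar>\<^sup>2"
        have "(\<Sum>k<N. (infnorm (?S (z k)))\<^sup>2) \<le> ?p\<^sup>2 * ?s"
          using two_summing_bound_factorization[OF T] unfolding two_summing_bound_def by blast
        also have "\<dots> \<le> (?p + r)\<^sup>2 * ?s"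
        proof (intro mult_right_mono power_mono)
          have "0 \<le> (\<Sum>k<N. (axis undefined 1 \<bullet> z k)\<^sup>2)"
            by (simp add: sum_nonneg)
          also have "\<dots> \<le> ?s"
            using weak_sum_le_SUP[where y = "axis undefined 1" and z = z and N = N] by simp
          finally show "0 \<le> ?s" .
        qed (use p that in auto)
        finally show "(\<Sum>k<N. (infnorm (?S (z k)))\<^sup>2) \<le> (?p + r)\<^sup>2 * ?s" .
      qed
      then show ?thesis
        unfolding two_summing_norm_def plus_ereal.simps(1) using p that
        by (intro Inf_lower) (auto simp del: transpose_matrix_vector)
    qed
    then show "?pi \<le> e"
      unfolding e by (rule ereal_le_epsilon2)
  qed
  moreover have "Inf ?F \<le> ?pi"
    unfolding two_summing_norm_def
  proof (rule Inf_mono)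
    fix e assume "e \<in> ?C"
    then obtain c where c: "e = ereal c" "0 < c" "two_summing_bound norm infnorm ?S c"
      unfolding mem_Collect_eq by (elim exE conjE)
    obtain d T1 T2 where T: "factorizes T d T1 T2"
      and le: "frobenius_norm d T1 * opnorm_l1_l2 d T2 \<le> c"
      by (rule factorization_of_two_summing_bound[OF c(3,2)])
    have "ereal (frobenius_norm d T1 * opnorm_l1_l2 d T2) \<in> ?F"
      using T by blast
    then show "\<exists>a\<in>?F. a \<le> e"
      by (rule bexI[rotated]) (simp add: c(1) le)
  qed
  ultimately have pi_eq: "?pi = Inf ?F"
    by (rule order_antisym)
  have "Inf ?F \<le> Inf ?W"
  proof (rule Inf_mono)
    fix e assume "e \<in> ?W"
    then obtain W1 W2 where W: "e = ereal (max (trace W1) (infnorm (diag_vec W2)))"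
      "pos_semidef (block_matrix W1 T (transpose T) W2)"
      by blast
    obtain d T1 T2 where T: "factorizes T d T1 T2"
      and le: "frobenius_norm d T1 * opnorm_l1_l2 d T2 \<le> max (trace W1) (infnorm (diag_vec W2))"
      by (rule factorization_of_block[OF W(2)])
    have "ereal (frobenius_norm d T1 * opnorm_l1_l2 d T2) \<in> ?F"
      using T by blast
    then show "\<exists>a\<in>?F. a \<le> e"
      by (rule bexI[rotated]) (simp only: W(1) ereal_less_eq le)
  qed
  moreover have "Inf ?W \<le> Inf ?F"
  proof (rule Inf_mono)
    fix e assume "e \<in> ?F"
    then obtain d T1 T2 where T: "factorizes T d T1 T2"
      and e: "e = ereal (frobenius_norm d T1 * opnorm_l1_l2 d T2)"
      by blast
    obtain W1 W2 where W: "symmetric_matrix W1" "symmetric_matrix W2"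
      "pos_semidef (block_matrix W1 T (transpose T) W2)"
      "max (trace W1) (infnorm (diag_vec W2)) \<le> frobenius_norm d T1 * opnorm_l1_l2 d T2"
      by (rule block_of_factorization[OF T])
    have "ereal (max (trace W1) (infnorm (diag_vec W2))) \<in> ?W"
      using W(1-3) by blast
    then show "\<exists>a\<in>?W. a \<le> e"
      by (rule bexI[rotated]) (simp only: e ereal_less_eq W(4))
  qed
  ultimately have "Inf ?F = Inf ?W"
    by (rule order_antisym)
  then show ?thesis
    by (intro conjI pi_eq trans[OF pi_eq])
qed

end
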